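(* Every connected graph $G$ has a rooted spanning tree that is end-faithful for the set of topological ends of $G$.
   Context: Graphs may be infinite. A vertex-end of a graph $G$ is an equivalence class of rays (one-way infinite paths), where two rays are equivalent if they cannot be separated in $G$ by removing finitely many vertices. A vertex $v$ dominates a vertex-end $\omega$ if for some (equivalently: every) ray $R$ belonging to $\omega$ there is an infinite fan of $v$-$R$-paths that are vertex-disjoint except at $v$. A topological end of $G$ is a vertex-end of $G$ that is not dominated by any vertex. A rooted spanning tree $T$ of $G$ is end-faithful for a set $\Psi$ of vertex-ends of $G$ if for each $\omega\in\Psi$ the tree $T$ contains a unique ray that starts at the root and belongs to $\omega$. *)

theory Defs
  imports Main
begin

text \<open>
  Simple undirected graphs, finite or infinite, are given by a vertex set \<open>V\<close> and a set \<open>E\<close> of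
  two-element subsets of \<open>V\<close>.
\<close>

definition simple_graph :: "'a set \<Rightarrow> 'a set set \<Rightarrow> bool" where
  "simple_graph V E \<longleftrightarrow> E \<subseteq> {{u, v} | u v. u \<in> V \<and> v \<in> V \<and> u \<noteq> v}"

text \<open>A path is the list of its vertices; a single vertex is a (trivial) path.\<close>

definition graph_path :: "'a set \<Rightarrow> 'a set set \<Rightarrow> 'a list \<Rightarrow> bool" where
  "graph_path V E xs \<longleftrightarrow>
     xs \<noteq> [] \<and> set xs \<subseteq> V \<and> distinct xs \<and> successively (\<lambda>u v. {u, v} \<in> E) xs"

definition connected_graph :: "'a set \<Rightarrow> 'a set set \<Rightarrow> bool" where
  "connected_graph V E \<longleftrightarrow>
     V \<noteq> {} \<and> (\<forall>u\<in>V. \<forall>v\<in>V. \<exists>xs. graph_path V E xs \<and> hd xs = u \<and> last xs = v)"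

definition graph_cycle :: "'a set \<Rightarrow> 'a set set \<Rightarrow> 'a list \<Rightarrow> bool" where
  "graph_cycle V E xs \<longleftrightarrow> graph_path V E xs \<and> length xs \<ge> 3 \<and> {last xs, hd xs} \<in> E"

definition graph_tree :: "'a set \<Rightarrow> 'a set set \<Rightarrow> bool" where
  "graph_tree V F \<longleftrightarrow> simple_graph V F \<and> connected_graph V F \<and> (\<nexists>xs. graph_cycle V F xs)"

text \<open>A rooted spanning tree of \<open>(V, E)\<close> is given by its edge set \<open>F\<close> and its root \<open>r\<close>.\<close>

definition rooted_spanning_tree :: "'a set \<Rightarrow> 'a set set \<Rightarrow> 'a set set \<Rightarrow> 'a \<Rightarrow> bool" where
  "rooted_spanning_tree V E F r \<longleftrightarrow> F \<subseteq> E \<and> graph_tree V F \<and> r \<in> V"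

text \<open>
  A ray is enumerated from its first vertex, which determines the enumeration: distinct functions
  are distinct rays.
\<close>

definition ray :: "'a set \<Rightarrow> 'a set set \<Rightarrow> (nat \<Rightarrow> 'a) \<Rightarrow> bool" where
  "ray V E R \<longleftrightarrow> range R \<subseteq> V \<and> inj R \<and> (\<forall>n. {R n, R (Suc n)} \<in> E)"

definition separates :: "'a set \<Rightarrow> 'a set set \<Rightarrow> 'a set \<Rightarrow> 'a set \<Rightarrow> 'a set \<Rightarrow> bool" where
  "separates V E S A B \<longleftrightarrow>
     (\<forall>xs. graph_path V E xs \<and> hd xs \<in> A \<and> last xs \<in> B \<longrightarrow> set xs \<inter> S \<noteq> {})"

definition ray_equiv :: "'a set \<Rightarrow> 'a set set \<Rightarrow> ((nat \<Rightarrow> 'a) \<times> (nat \<Rightarrow> 'a)) set" where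
  "ray_equiv V E = {(R, Q). ray V E R \<and> ray V E Q \<and>
     (\<nexists>S. finite S \<and> S \<subseteq> V \<and> separates V E S (range R) (range Q))}"

definition vertex_ends :: "'a set \<Rightarrow> 'a set set \<Rightarrow> (nat \<Rightarrow> 'a) set set" where
  "vertex_ends V E = {R. ray V E R} // ray_equiv V E"

text \<open>
  A member of a fan from \<open>v\<close> to \<open>R\<close> meets \<open>R\<close> after \<open>v\<close> exactly in its last vertex. Since \<open>v\<close> itself
  may lie on \<open>R\<close>, the condition is on the tail of the path; it forces the path to be nontrivial.
\<close>

definition infinite_fan :: "'a set \<Rightarrow> 'a set set \<Rightarrow> 'a \<Rightarrow> (nat \<Rightarrow> 'a) \<Rightarrow> 'a list set \<Rightarrow> bool" where
  "infinite_fan V E v R P \<longleftrightarrow> infinite P \<and>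
     (\<forall>xs\<in>P. graph_path V E xs \<and> hd xs = v \<and> set (tl xs) \<inter> range R = {last xs}) \<and>
     (\<forall>xs\<in>P. \<forall>ys\<in>P. xs \<noteq> ys \<longrightarrow> set xs \<inter> set ys = {v})"

definition dominates :: "'a set \<Rightarrow> 'a set set \<Rightarrow> 'a \<Rightarrow> (nat \<Rightarrow> 'a) set \<Rightarrow> bool" where
  "dominates V E v \<omega> \<longleftrightarrow> (\<exists>R\<in>\<omega>. \<exists>P. infinite_fan V E v R P)"

definition topological_ends :: "'a set \<Rightarrow> 'a set set \<Rightarrow> (nat \<Rightarrow> 'a) set set" where
  "topological_ends V E = {\<omega> \<in> vertex_ends V E. \<not> (\<exists>v\<in>V. dominates V E v \<omega>)}"

text \<open>The ends in \<open>\<Psi>\<close> are ends of the ambient graph, not of the tree \<open>(V, F)\<close>.\<close>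

definition end_faithful :: "'a set \<Rightarrow> 'a set set \<Rightarrow> 'a \<Rightarrow> (nat \<Rightarrow> 'a) set set \<Rightarrow> bool" where
  "end_faithful V F r \<Psi> \<longleftrightarrow> (\<forall>\<omega>\<in>\<Psi>. \<exists>!R. ray V F R \<and> R 0 = r \<and> R \<in> \<omega>)"

end

theory Submission
  imports Defs
begin

text \<open>
  Fix a vertex \<open>r\<close>. The tree is built along an increasing sequence of vertex sets
  \<open>X 0 = {r}\<close>, \<open>X 1\<close>, \<open>X 2\<close>, \<open>\<dots>\<close> that exhausts the graph. Given \<open>X n\<close>, choose in each component
  \<open>C\<close> of \<open>G - X n\<close> a spanning tree rooted at a vertex that has a neighbour in \<open>X n\<close>, and attach its
  root to such a neighbour. The set \<open>X (n + 1)\<close> consists of \<open>X n\<close>, the neighbours of \<open>X n\<close>, and all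
  their ancestors in these trees. Giving each vertex of \<open>X (n + 1)\<close> outside \<open>X n\<close> the parent that it
  has in the tree of its component of \<open>G - X n\<close> defines one spanning tree \<open>T\<close> of \<open>G\<close> with root \<open>r\<close>.
  Since all neighbours of \<open>X n\<close> lie in \<open>X (n + 1)\<close>, the tree \<open>T\<close> enters each component of
  \<open>G - X n\<close>, for every \<open>n\<close>, at a single vertex (\<open>entry_unique\<close>, \<open>entry_exists\<close>).

  Let \<open>R\<close> be a ray of an undominated end. For every \<open>n\<close>, some finite set separates a tail of \<open>R\<close>
  from \<open>X n\<close>. This is preserved from \<open>X n\<close> to \<open>X (n + 1)\<close> (\<open>cut_off_grow\<close>): only finitely many
  vertices \<open>v\<close> of \<open>X n\<close> lie in the separator, and each of them is separated from a tail of \<open>R\<close> by a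
  finite set avoiding \<open>v\<close>, as it does not dominate the end. Adding these finite sets separates a
  tail of \<open>R\<close> from \<open>X n\<close> and its neighbours. The tree path from such a neighbour to an ancestor on
  the side of \<open>R\<close> then passes through the separator, so the ancestors on that side are ancestors of
  separator vertices; there are finitely many of these, and they can be added to the separator.

  Hence for every \<open>n\<close> a tail of \<open>R\<close>, and of every ray equivalent to \<open>R\<close>, lies in one component
  \<open>C n\<close> of \<open>G - X n\<close>. A ray of \<open>T\<close> that starts at \<open>r\<close> and belongs to the end of \<open>R\<close> must pass through
  the entry vertex \<open>c n\<close> of \<open>T\<close> into \<open>C n\<close> for every \<open>n\<close>, so there is at most one. Conversely, the
  vertices \<open>c n\<close> lie on one branch of \<open>T\<close> and define a ray. It is equivalent to \<open>R\<close>: a finite vertex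
  set is contained in some \<open>X n\<close>, hence it misses the connected set \<open>C n\<close>, which meets both rays.
\<close>

section \<open>Reachability outside a set of vertices\<close>

text \<open>
  Adjacency in \<open>G - S\<close>. The set \<open>S\<close> need not consist of vertices. The reflexive transitive closure
  \<open>reach V E S\<close> relates every \<open>a\<close> to itself, even if \<open>a\<close> is not a vertex of \<open>G - S\<close>; on \<open>V - S\<close> its
  classes are the components of \<open>G - S\<close>.
\<close>

definition adj_avoiding :: "'a set \<Rightarrow> 'a set set \<Rightarrow> 'a set \<Rightarrow> 'a \<Rightarrow> 'a \<Rightarrow> bool" where
  "adj_avoiding V E S a b \<longleftrightarrow> {a, b} \<in> E \<and> a \<in> V - S \<and> b \<in> V - S"

abbreviation reach :: "'a set \<Rightarrow> 'a set set \<Rightarrow> 'a set \<Rightarrow> 'a \<Rightarrow> 'a \<Rightarrow> bool" where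
  "reach V E S \<equiv> (adj_avoiding V E S)\<^sup>*\<^sup>*"

lemma adj_avoiding_sym: "adj_avoiding V E S a b \<Longrightarrow> adj_avoiding V E S b a"
  by (auto simp: adj_avoiding_def insert_commute)

lemma reach_sym: "reach V E S a b \<Longrightarrow> reach V E S b a"
  by (induction rule: rtranclp_induct) (auto intro: adj_avoiding_sym converse_rtranclp_into_rtranclp)

lemma reach_avoids: "reach V E S a b \<Longrightarrow> a \<in> V - S \<Longrightarrow> b \<in> V - S"
  by (induction rule: rtranclp_induct) (auto simp: adj_avoiding_def)

lemma reach_antimono: "reach V E S' a b \<Longrightarrow> S \<subseteq> S' \<Longrightarrow> reach V E S a b"
  by (erule rtranclp_mono[THEN predicate2D, rotated]) (auto simp: adj_avoiding_def)

text \<open>A component of \<open>G - S\<close> that misses \<open>X\<close> lies in one component of \<open>G - X\<close>.\<close>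

lemma reach_change:
  assumes "reach V E S a b" and "\<And>x. reach V E S a x \<Longrightarrow> x \<notin> X"
  shows "reach V E X a b"
  using assms(1)
proof (induction rule: rtranclp_induct)
  case (step y z)
  have "reach V E S a z" using step.hyps by (rule rtranclp.rtrancl_into_rtrancl)
  then have "adj_avoiding V E X y z"
    using step.hyps assms(2) by (auto simp: adj_avoiding_def)
  with step.IH show ?case by (rule rtranclp.rtrancl_into_rtrancl)
qed simp

lemma reach_imp_path:
  assumes "reach V E S a b" and "a \<in> V - S"
  shows "\<exists>xs. graph_path V E xs \<and> hd xs = a \<and> last xs = b \<and> set xs \<inter> S = {}"
  using assms(1)
proof (induction rule: rtranclp_induct)
  case base
  show ?case using assms(2) by (intro exI[of _ "[a]"]) (auto simp: graph_path_def)
next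
  case (step y z)
  then obtain xs where xs: "graph_path V E xs" "hd xs = a" "last xs = y" "set xs \<inter> S = {}"
    by blast
  show ?case
  proof (cases "z \<in> set xs")
    case True
    then obtain us vs where uv: "xs = us @ z # vs" by (meson split_list)
    have "xs = (us @ [z]) @ vs" using uv by simp
    then have "graph_path V E (us @ [z])" "set (us @ [z]) \<inter> S = {}"
      using xs by (auto simp: graph_path_def successively_append_iff)
    moreover have "hd (us @ [z]) = a" using xs(2) uv by (cases us) auto
    ultimately show ?thesis by (intro exI[of _ "us @ [z]"]) auto
  next
    case False
    have "graph_path V E (xs @ [z])"
      using xs step.hyps False
      by (auto simp: graph_path_def successively_append_iff adj_avoiding_def)
    then show ?thesis using xs step.hyps
      by (intro exI[of _ "xs @ [z]"]) (auto simp: graph_path_def adj_avoiding_def)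
  qed
qed

lemma path_imp_reach:
  "graph_path V E xs \<Longrightarrow> set xs \<inter> S = {} \<Longrightarrow> reach V E S (hd xs) (last xs)"
proof (induction xs)
  case (Cons x xs)
  show ?case
  proof (cases xs)
    case (Cons y ys)
    have "reach V E S (hd xs) (last xs)"
      using Cons.prems Cons by (intro Cons.IH) (auto simp: graph_path_def)
    moreover have "adj_avoiding V E S x y"
      using Cons.prems Cons by (auto simp: graph_path_def adj_avoiding_def)
    ultimately show ?thesis using Cons by (auto intro: converse_rtranclp_into_rtranclp)
  qed simp
qed (simp add: graph_path_def)

lemma reach_exit:
  assumes "reach V E S a b" "a \<in> A" "b \<notin> A"
  shows "\<exists>u v. u \<in> A \<and> v \<notin> A \<and> adj_avoiding V E S u v"
  using assms by (induction rule: rtranclp_induct) auto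

lemma connected_reach:
  assumes "connected_graph V E" "u \<in> V" "v \<in> V"
  shows "reach V E {} u v"
  using assms path_imp_reach[of V E _ "{}"] unfolding connected_graph_def by fastforce

section \<open>Trees given by parent maps\<close>

text \<open>
  A rooted tree is encoded by the map \<open>p\<close> that sends every vertex other than the root to its parent;
  the root is a fixed point, and iterating \<open>p\<close> leads from every vertex to the root.
\<close>

definition parent_edges :: "'a set \<Rightarrow> 'a \<Rightarrow> ('a \<Rightarrow> 'a) \<Rightarrow> 'a set set" where
  "parent_edges V r p = {{v, p v} | v. v \<in> V \<and> v \<noteq> r}"

locale parent_tree =
  fixes V :: "'a set" and r :: 'a and p :: "'a \<Rightarrow> 'a"
  assumes root: "r \<in> V" and p_root: "p r = r"
    and p_closed: "v \<in> V \<Longrightarrow> p v \<in> V"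
    and p_reaches_root: "v \<in> V \<Longrightarrow> \<exists>k. (p ^^ k) v = r"
begin

text \<open>The distance of a vertex from the root in the tree.\<close>

definition depth :: "'a \<Rightarrow> nat" where
  "depth v = (LEAST k. (p ^^ k) v = r)"

lemma funpow_depth: "v \<in> V \<Longrightarrow> (p ^^ depth v) v = r"
  unfolding depth_def by (rule LeastI_ex) (rule p_reaches_root)

lemma depth_root: "depth r = 0"
  unfolding depth_def by (rule Least_eq_0) simp

lemma depth_parent: "v \<in> V \<Longrightarrow> v \<noteq> r \<Longrightarrow> depth v = Suc (depth (p v))"
  unfolding depth_def
  using Least_Suc[of "\<lambda>k. (p ^^ k) v = r" "depth v"] funpow_depth[of v]
  by (simp add: funpow_Suc_right del: funpow.simps)

lemma depth_funpow:
  "v \<in> V \<Longrightarrow> k \<le> depth v \<Longrightarrow> (p ^^ k) v \<in> V \<and> depth ((p ^^ k) v) = depth v - k"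
proof (induction k)
  case (Suc k)
  then have *: "(p ^^ k) v \<in> V" "depth ((p ^^ k) v) = depth v - k" by auto
  then have "(p ^^ k) v \<noteq> r" using Suc.prems depth_root by auto
  from depth_parent[OF *(1) this] * Suc.prems show ?case by (auto simp: p_closed)
qed simp

lemma edge_iff:
  "{u, v} \<in> parent_edges V r p \<longleftrightarrow> (u \<in> V \<and> u \<noteq> r \<and> v = p u) \<or> (v \<in> V \<and> v \<noteq> r \<and> u = p v)"
  by (auto simp: parent_edges_def doubleton_eq_iff)

lemma no_cycle: "\<not> graph_cycle V (parent_edges V r p) xs"
proof
  assume "graph_cycle V (parent_edges V r p) xs"
  then have xs: "set xs \<subseteq> V" "distinct xs" "length xs \<ge> 3"
    "successively (\<lambda>u v. {u, v} \<in> parent_edges V r p) xs"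
    "{last xs, hd xs} \<in> parent_edges V r p"
    by (auto simp: graph_cycle_def graph_path_def)
  define n where "n = length xs"
  have ne: "xs \<noteq> []" using xs(3) by auto
  have n3: "n \<ge> 3" using xs n_def by simp
  have edge: "{xs ! i, xs ! (Suc i mod n)} \<in> parent_edges V r p" if "i < n" for i
  proof (cases "Suc i < n")
    case True
    then show ?thesis using xs(4) by (auto simp: successively_conv_nth n_def)
  next
    case False
    then have "Suc i = n" using that by simp
    then have "xs ! i = last xs" "xs ! (Suc i mod n) = hd xs"
      using ne by (auto simp: last_conv_nth hd_conv_nth n_def) (metis diff_Suc_1 One_nat_def)
    then show ?thesis using xs(5) by simp
  qed
  \<comment> \<open>Both neighbours on the cycle of a vertex of maximal depth are its parent.\<close>
  obtain i where i: "i < n" "\<And>j. j < n \<Longrightarrow> depth (xs ! j) \<le> depth (xs ! i)"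
  proof -
    have "Max ((\<lambda>j. depth (xs ! j)) ` {..<n}) \<in> (\<lambda>j. depth (xs ! j)) ` {..<n}"
      using n3 by (intro Max_in) (auto simp: lessThan_empty_iff)
    then obtain i where "i < n" "depth (xs ! i) = Max ((\<lambda>j. depth (xs ! j)) ` {..<n})" by auto
    then show ?thesis by (intro that[of i]) auto
  qed
  have up: "xs ! j = p (xs ! i)" if "j < n" "{xs ! i, xs ! j} \<in> parent_edges V r p" for j
    using that i(2)[OF that(1)] depth_parent[of "xs ! j"] by (auto simp: edge_iff)
  define j where "j = (if i = 0 then n - 1 else i - 1)"
  have j: "j < n" "Suc j mod n = i" using i n3 by (auto simp: j_def)
  have k: "Suc i mod n < n" using n3 by simp
  have "xs ! j = p (xs ! i)" using edge[OF j(1)] j by (intro up) (auto simp: insert_commute)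
  moreover have "xs ! (Suc i mod n) = p (xs ! i)" using edge[OF i(1)] k by (intro up) auto
  ultimately have "j = Suc i mod n"
    using xs(2) j k by (metis n_def nth_eq_iff_index_eq)
  moreover have "j \<noteq> Suc i mod n"
  proof (cases "Suc i < n")
    case False
    then have "Suc i = n" using i by simp
    then show ?thesis using n3 by (auto simp: j_def)
  qed (use n3 in \<open>auto simp: j_def\<close>)
  ultimately show False by simp
qed

lemma parent_edges_tree: "graph_tree V (parent_edges V r p)"
proof -
  let ?F = "parent_edges V r p"
  have "v \<noteq> p v" if "v \<in> V" "v \<noteq> r" for v using depth_parent[OF that] by auto
  then have simple: "simple_graph V ?F"
    by (auto simp: simple_graph_def parent_edges_def) (metis p_closed)
  have to_root: "reach V ?F {} v r" if "v \<in> V" for v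
    using that
  proof (induction "depth v" arbitrary: v rule: less_induct)
    case less
    show ?case
    proof (cases "v = r")
      case False
      have "adj_avoiding V ?F {} v (p v)"
        using False less.prems by (auto simp: adj_avoiding_def edge_iff p_closed)
      moreover have "reach V ?F {} (p v) r"
        using False less.prems depth_parent by (intro less.hyps) (auto simp: p_closed)
      ultimately show ?thesis by (rule converse_rtranclp_into_rtranclp)
    qed simp
  qed
  have "connected_graph V ?F"
    unfolding connected_graph_def
  proof (intro conjI ballI)
    fix u v assume uv: "u \<in> V" "v \<in> V"
    have "reach V ?F {} u v"
      using to_root[OF uv(1)] reach_sym[OF to_root[OF uv(2)]] by (rule rtranclp_trans)
    from reach_imp_path[OF this] uv
    show "\<exists>xs. graph_path V ?F xs \<and> hd xs = u \<and> last xs = v" by auto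
  qed (use root in auto)
  with simple no_cycle show ?thesis by (auto simp: graph_tree_def)
qed

text \<open>A ray that starts at the root leads away from it in every step.\<close>

lemma root_ray_parent:
  assumes "ray V (parent_edges V r p) Q" "Q 0 = r"
  shows "p (Q (Suc i)) = Q i" and "depth (Q i) = i"
proof -
  have Q: "inj Q" "range Q \<subseteq> V" "\<And>i. {Q i, Q (Suc i)} \<in> parent_edges V r p"
    using assms by (auto simp: ray_def)
  have par: "p (Q (Suc i)) = Q i" for i
  proof (induction i)
    case 0
    show ?case using Q(3)[of 0] assms(2) by (auto simp: edge_iff)
  next
    case (Suc i)
    have "Q (Suc (Suc i)) \<noteq> Q i" using Q(1) by (auto dest: injD)
    then show ?case using Q(3)[of "Suc i"] Suc by (auto simp: edge_iff)
  qed
  then show "p (Q (Suc i)) = Q i" .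
  have "Q (Suc i) \<noteq> r" for i using Q(1) assms(2) by (metis injD nat.distinct(1))
  then show "depth (Q i) = i"
    using assms(2) depth_root depth_parent par Q(2) by (induction i) (auto simp: range_subsetD)
qed

lemma root_ray_below:
  assumes "ray V (parent_edges V r p) Q" "Q 0 = r"
  shows "(p ^^ k) (Q (i + k)) = Q i"
proof (induction k)
  case (Suc k)
  have "(p ^^ Suc k) (Q (i + Suc k)) = (p ^^ k) (p (Q (Suc (i + k))))"
    by (simp add: funpow_Suc_right del: funpow.simps)
  also have "\<dots> = Q i" using Suc root_ray_parent(1)[OF assms] by simp
  finally show ?case .
qed simp

text \<open>
  Vertices \<open>c 0\<close>, \<open>c 1\<close>, \<open>\<dots>\<close>, each a proper ancestor of the next, determine a ray from the root. The
  bound \<open>k \<le> depth (c (Suc n))\<close> excludes the spurious ancestors obtained by iterating \<open>p\<close> beyond the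
  root, where it is constant.
\<close>

lemma branch_ray:
  assumes c: "\<And>n. c n \<in> V" and anc: "\<And>n. \<exists>k>0. k \<le> depth (c (Suc n)) \<and> (p ^^ k) (c (Suc n)) = c n"
  shows "\<exists>Q. ray V (parent_edges V r p) Q \<and> Q 0 = r \<and> (\<forall>n. n \<le> depth (c n) \<and> Q (depth (c n)) = c n)"
proof -
  have mono: "depth (c n) < depth (c (Suc n))" for n
    using anc[of n] depth_funpow[OF c[of "Suc n"]] by (metis diff_less dual_order.strict_trans1)
  have ge: "n \<le> depth (c n)" for n
    using mono by (induction n) (auto intro: Suc_leI le_less_trans)
  define Q where "Q i = (p ^^ (depth (c i) - i)) (c i)" for i
  \<comment> \<open>The ancestor at depth \<open>i\<close> is the same for all \<open>c n\<close> of depth at least \<open>i\<close>.\<close>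
  have step: "(p ^^ (depth (c (Suc n)) - i)) (c (Suc n)) = (p ^^ (depth (c n) - i)) (c n)"
    if "i \<le> depth (c n)" for i n
  proof -
    obtain k where k: "k \<le> depth (c (Suc n))" "(p ^^ k) (c (Suc n)) = c n" using anc by blast
    then have "depth (c n) = depth (c (Suc n)) - k" using depth_funpow[OF c] by metis
    then have "depth (c (Suc n)) - i = (depth (c n) - i) + k" using k that by simp
    then show ?thesis using k by (simp add: funpow_add)
  qed
  have indep: "i \<le> depth (c n) \<Longrightarrow> (p ^^ (depth (c (n + m)) - i)) (c (n + m)) = (p ^^ (depth (c n) - i)) (c n)"
    for i n m
  proof (induction m)
    case (Suc m)
    have "depth (c n) \<le> depth (c (n + m))"
      using lift_Suc_mono_le[of "\<lambda>n. depth (c n)" n "n + m"] mono by (simp add: less_imp_le)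
    then show ?case using Suc step[of i "n + m"] by simp
  qed simp
  have Q: "Q i = (p ^^ (depth (c n) - i)) (c n)" if "i \<le> depth (c n)" for i n
    using indep[of i n "i - n"] indep[of i i "n - i"] that ge[of i]
    by (cases "i \<le> n") (auto simp: Q_def)
  have par: "p (Q (Suc i)) = Q i" for i
  proof -
    have "depth (c (Suc i)) - i = Suc (depth (c (Suc i)) - Suc i)" using ge[of "Suc i"] by simp
    then show ?thesis using Q[of i "Suc i"] Q[of "Suc i" "Suc i"] ge[of "Suc i"] by simp
  qed
  have QV: "Q i \<in> V" and Qd: "depth (Q i) = i" for i
    using depth_funpow[OF c, of "depth (c i) - i" i] ge[of i] by (auto simp: Q_def)
  have "inj Q" using Qd by (metis injI)
  moreover have "{Q i, Q (Suc i)} \<in> parent_edges V r p" for i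
    using par[of i] QV Qd[of "Suc i"] depth_root by (auto simp: edge_iff)
  ultimately have "ray V (parent_edges V r p) Q" using QV by (auto simp: ray_def)
  moreover have "Q 0 = r" using funpow_depth[OF c[of 0]] by (simp add: Q_def)
  moreover have "Q (depth (c n)) = c n" for n using Q[of "depth (c n)" n] by simp
  ultimately show ?thesis using ge by blast
qed

end

section \<open>Undominated rays\<close>

text \<open>
  The finite set \<open>S\<close> avoids the tail of \<open>R\<close> from index \<open>m\<close> on and separates it from \<open>X\<close>: the component
  of \<open>G - S\<close> containing that tail misses \<open>X\<close>.
\<close>

definition cut_off :: "'a set \<Rightarrow> 'a set set \<Rightarrow> (nat \<Rightarrow> 'a) \<Rightarrow> 'a set \<Rightarrow> 'a set \<Rightarrow> nat \<Rightarrow> bool" where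
  "cut_off V E R X S m \<longleftrightarrow>
     finite S \<and> (\<forall>i\<ge>m. R i \<notin> S) \<and> (\<forall>x. reach V E S (R m) x \<longrightarrow> x \<notin> X)"

lemma ray_eventually_avoids:
  assumes "ray V E R" "finite S"
  shows "\<exists>m. \<forall>i\<ge>m. R i \<notin> S"
proof -
  have "finite (R -` S)" using assms by (auto simp: ray_def intro: finite_vimageI)
  then obtain m where "\<forall>i\<in>R -` S. i < m" using finite_nat_set_iff_bounded by blast
  then show ?thesis by (intro exI[of _ m]) (auto simp: not_less[symmetric])
qed

lemma ray_tail_reach:
  assumes "ray V E R" "\<forall>i\<ge>m. R i \<notin> S" "m \<le> i"
  shows "reach V E S (R m) (R i)"
  using assms(3)
proof (induction i rule: dec_induct)
  case (step i)
  have "adj_avoiding V E S (R i) (R (Suc i))"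
    using assms step.hyps by (auto simp: ray_def adj_avoiding_def)
  with step.IH show ?case by (rule rtranclp.rtrancl_into_rtrancl)
qed simp

text \<open>
  If no finite set avoiding \<open>v\<close> separates \<open>v\<close> from \<open>R\<close>, then \<open>v\<close> sends an infinite fan to \<open>R\<close>: choose
  its paths one after the other, each avoiding the earlier ones except at \<open>v\<close>. The target must differ
  from \<open>v\<close>, which may itself lie on \<open>R\<close>.
\<close>

lemma infinite_fanI:
  assumes v: "v \<in> V"
    and unsep: "\<And>S. finite S \<Longrightarrow> v \<notin> S \<Longrightarrow> \<exists>i. R i \<noteq> v \<and> reach V E S v (R i)"
  shows "\<exists>P. infinite_fan V E v R P"
proof -
  define good where "good xs \<longleftrightarrow> graph_path V E xs \<and> hd xs = v \<and> set (tl xs) \<inter> range R = {last xs}"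
    for xs
  have ex: "\<exists>xs. good xs \<and> set xs \<inter> S = {}" if S: "finite S" "v \<notin> S" for S
  proof -
    obtain i where i: "R i \<noteq> v" "reach V E S v (R i)" using unsep S by blast
    obtain xs where xs: "graph_path V E xs" "hd xs = v" "last xs = R i" "set xs \<inter> S = {}"
      using reach_imp_path[OF i(2)] v S by blast
    then obtain ys where ys: "xs = v # ys" by (cases xs) (auto simp: graph_path_def)
    have "ys \<noteq> []" using ys xs i by auto
    then have "last ys = R i" using xs(3) ys by simp
    with last_in_set[OF \<open>ys \<noteq> []\<close>] have "\<exists>y\<in>set ys. y \<in> range R" by auto
    \<comment> \<open>Cut the path at its first vertex on \<open>R\<close> after \<open>v\<close>.\<close>
    then obtain us y vs where y: "ys = us @ y # vs" "y \<in> range R" "\<forall>u\<in>set us. u \<notin> range R"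
      using split_list_first_prop[of ys "\<lambda>y. y \<in> range R"] by blast
    have eq: "xs = (v # us @ [y]) @ vs" using ys y by simp
    then have "graph_path V E (v # us @ [y])"
      using xs(1) unfolding eq graph_path_def successively_append_iff by auto
    moreover have "set (v # us @ [y]) \<inter> S = {}" using xs(4) eq by auto
    ultimately show ?thesis using y
      by (intro exI[of _ "v # us @ [y]"]) (auto simp: good_def)
  qed
  have "\<exists>f. \<forall>n::nat. good (f n) \<and> set (f n) \<inter> ((\<Union>m<n. set (f m)) - {v}) = {}"
  proof (rule dependent_wellorder_choice)
    fix n :: nat and f :: "nat \<Rightarrow> 'a list"
    show "\<exists>xs. good xs \<and> set xs \<inter> ((\<Union>m<n. set (f m)) - {v}) = {}" by (rule ex) auto
  qed auto
  then obtain f where f: "\<And>n. good (f n)"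
    and f': "\<And>n::nat. set (f n) \<inter> ((\<Union>m<n. set (f m)) - {v}) = {}"
    by blast
  have f_less: "set (f n) \<inter> set (f m) \<subseteq> {v}" if "m < n" for m n
    using f'[of n] that by auto
  have v_in: "v \<in> set (f n)" for n
    using f[of n] by (auto simp: good_def graph_path_def dest: hd_in_set)
  have disj: "set (f m) \<inter> set (f n) = {v}" if "m \<noteq> n" for m n
  proof -
    have "set (f m) \<inter> set (f n) \<subseteq> {v}"
      using that f_less[of m n] f_less[of n m] by (cases m n rule: linorder_cases) auto
    then show ?thesis using v_in by blast
  qed
  have last_ne: "last (f n) \<in> set (f n) - {v}" for n
  proof -
    have *: "last (f n) \<in> set (tl (f n))" "hd (f n) = v" "distinct (f n)" "f n \<noteq> []"
      using f[of n] by (auto simp: good_def graph_path_def)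
    then show ?thesis by (cases "f n") auto
  qed
  have "inj f"
  proof (rule injI, rule ccontr)
    fix m n assume "f m = f n" "m \<noteq> n"
    then have "set (f n) = {v}" using disj[OF \<open>m \<noteq> n\<close>] by simp
    then show False using last_ne[of n] by simp
  qed
  then have "infinite (range f)" by (auto dest: finite_imageD)
  moreover have "\<forall>xs\<in>range f. good xs" using f by simp
  moreover have "\<forall>xs\<in>range f. \<forall>ys\<in>range f. xs \<noteq> ys \<longrightarrow> set xs \<inter> set ys = {v}"
  proof (intro ballI impI)
    fix xs ys assume "xs \<in> range f" "ys \<in> range f" "xs \<noteq> ys"
    then obtain m n where mn: "xs = f m" "ys = f n" "m \<noteq> n" by auto
    then show "set xs \<inter> set ys = {v}" using disj by simp
  qed
  ultimately have "infinite_fan V E v R (range f)"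
    unfolding infinite_fan_def good_def by (intro conjI)
  then show ?thesis by (rule exI[of _ "range f"])
qed

lemma undominated_separable:
  assumes R: "ray V E R" and v: "v \<in> V" and nofan: "\<nexists>P. infinite_fan V E v R P"
  shows "\<exists>S m. cut_off V E R {v} S m \<and> v \<notin> S"
proof -
  obtain S where S: "finite S" "v \<notin> S" "\<And>i. R i \<noteq> v \<Longrightarrow> \<not> reach V E S v (R i)"
    using infinite_fanI[OF v, of R E] nofan by blast
  obtain m where m: "\<forall>i\<ge>m. R i \<notin> insert v S"
    using ray_eventually_avoids[OF R, of "insert v S"] S(1) by auto
  then have "\<not> reach V E S (R m) v" using S(3)[of m] reach_sym by fastforce
  then show ?thesis using S m by (auto simp: cut_off_def)
qed

section \<open>Growing a vertex set\<close>

text \<open>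
  For a map \<open>q\<close> that fixes \<open>X\<close> pointwise and is a parent map outside \<open>X\<close>, \<open>grow V E X q\<close> adds to \<open>X\<close> its
  neighbours and all their ancestors.
\<close>

definition grow :: "'a set \<Rightarrow> 'a set set \<Rightarrow> 'a set \<Rightarrow> ('a \<Rightarrow> 'a) \<Rightarrow> 'a set" where
  "grow V E X q = X \<union> {(q ^^ k) u | k u. u \<in> V - X \<and> (\<exists>x\<in>X. {x, u} \<in> E)}"

text \<open>
  The map \<open>q\<close> encodes a spanning forest of \<open>G - X\<close> with exactly one tree in each component. A root is a
  vertex outside \<open>X\<close> that \<open>q\<close> sends into \<open>X\<close>, so \<open>q\<close> also attaches the trees to \<open>X\<close>; the last condition
  says that a component contains at most one root.
\<close>

definition rooted_forest :: "'a set \<Rightarrow> 'a set set \<Rightarrow> 'a set \<Rightarrow> ('a \<Rightarrow> 'a) \<Rightarrow> bool" where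
  "rooted_forest V E X q \<longleftrightarrow>
     (\<forall>x\<in>X. q x = x) \<and>
     (\<forall>v\<in>V - X. q v \<in> V \<and> {v, q v} \<in> E \<and> (\<exists>k. (q ^^ k) v \<in> X)) \<and>
     (\<forall>u\<in>V - X. \<forall>v\<in>V - X. q u \<in> X \<and> q v \<in> X \<and> reach V E X u v \<longrightarrow> u = v)"

text \<open>
  In each component of \<open>G - X\<close>, choose a root with a neighbour in \<open>X\<close> and let every other vertex point
  to a neighbour closer to the root.
\<close>

lemma rooted_forest_exists:
  assumes G: "connected_graph V E" and X: "X \<subseteq> V" "r \<in> X"
  shows "\<exists>q. rooted_forest V E X q"
proof -
  \<comment> \<open>The root \<open>root v\<close> of the component of \<open>v\<close> is chosen among its vertices with a neighbour in \<open>X\<close>.\<close>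
  define att where "att v u \<longleftrightarrow> reach V E X v u \<and> (\<exists>x\<in>X. {u, x} \<in> E)" for v u
  define root where "root v = (SOME u. att v u)" for v
  have att: "\<exists>u. att v u" if "v \<in> V - X" for v
  proof -
    have "reach V E {} v r" using G X that by (intro connected_reach) auto
    moreover have "r \<notin> Collect (reach V E X v)" using reach_avoids[OF _ that, of E r] X by auto
    ultimately obtain a b where ab: "reach V E X v a" "\<not> reach V E X v b" "adj_avoiding V E {} a b"
      using reach_exit[of V E "{}" v r "Collect (reach V E X v)"] by auto
    have "a \<in> V - X" using reach_avoids[OF ab(1) that] .
    then have "b \<in> X" using ab rtranclp.rtrancl_into_rtrancl[OF ab(1), of b]
      by (auto simp: adj_avoiding_def)
    then show ?thesis using ab by (auto simp: att_def adj_avoiding_def)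
  qed
  have root: "att v (root v)" if "v \<in> V - X" for v
    unfolding root_def using att[OF that] by (rule someI_ex)
  have root_eq: "root u = root v" if "reach V E X u v" for u v
  proof -
    have "att u = att v"
      using that reach_sym[OF that] by (auto simp: att_def fun_eq_iff intro: rtranclp_trans)
    then show ?thesis by (simp add: root_def)
  qed
  define dist where "dist v = (LEAST k. (adj_avoiding V E X ^^ k) v (root v))" for v
  have closer: "\<exists>w. adj_avoiding V E X v w \<and> dist w < dist v" if v: "v \<in> V - X" "v \<noteq> root v" for v
  proof -
    have "\<exists>k. (adj_avoiding V E X ^^ k) v (root v)"
      using root[OF v(1)] by (auto simp: att_def rtranclp_power)
    then have d: "(adj_avoiding V E X ^^ dist v) v (root v)" unfolding dist_def by (rule LeastI_ex)
    then obtain k where k: "dist v = Suc k" using v(2) by (cases "dist v") auto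
    obtain w where w: "adj_avoiding V E X v w" "(adj_avoiding V E X ^^ k) w (root v)"
      using d unfolding k by (meson relpowp_Suc_D2)
    have "root w = root v" using root_eq[of v w] r_into_rtranclp[of "adj_avoiding V E X", OF w(1)] by simp
    then have "dist w \<le> k" unfolding dist_def using w(2) by (intro Least_le) simp
    then show ?thesis using w(1) k by auto
  qed
  define q where "q v = (if v \<notin> V - X then v else if v = root v then SOME x. x \<in> X \<and> {v, x} \<in> E
    else SOME w. adj_avoiding V E X v w \<and> dist w < dist v)" for v
  have q_root: "q v \<in> X \<and> {v, q v} \<in> E" if v: "v \<in> V - X" "v = root v" for v
  proof -
    have "\<exists>x. x \<in> X \<and> {v, x} \<in> E" using root[OF v(1)] v(2) by (auto simp: att_def)
    from someI_ex[OF this] show ?thesis using v by (simp add: q_def)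
  qed
  have q_step: "adj_avoiding V E X v (q v) \<and> dist (q v) < dist v" if v: "v \<in> V - X" "v \<noteq> root v" for v
    using someI_ex[OF closer[OF v]] v by (simp add: q_def)
  have ends: "\<exists>k. (q ^^ k) v \<in> X" if "v \<in> V - X" for v
    using that
  proof (induction "dist v" arbitrary: v rule: less_induct)
    case less
    show ?case
    proof (cases "v = root v")
      case True
      then show ?thesis using q_root[OF less.prems] by (intro exI[of _ 1]) auto
    next
      case False
      note q = q_step[OF less.prems False]
      then obtain k where "(q ^^ k) (q v) \<in> X"
        using less.hyps[of "q v"] by (auto simp: adj_avoiding_def)
      then show ?thesis by (intro exI[of _ "Suc k"]) (simp add: funpow_Suc_right del: funpow.simps)
    qed
  qed
  have "q v \<in> V \<and> {v, q v} \<in> E" if "v \<in> V - X" for v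
    using q_root[OF that] q_step[OF that] X by (cases "v = root v") (auto simp: adj_avoiding_def)
  moreover have "u = root u" if "u \<in> V - X" "q u \<in> X" for u
    using q_step[OF that(1)] that(2) by (auto simp: adj_avoiding_def)
  then have "u = v" if "u \<in> V - X" "v \<in> V - X" "q u \<in> X" "q v \<in> X" "reach V E X u v" for u v
    using root_eq[OF that(5)] that by metis
  moreover have "q x = x" if "x \<in> X" for x using that by (simp add: q_def)
  ultimately have "rooted_forest V E X q" unfolding rooted_forest_def using ends by blast
  then show ?thesis by (rule exI[of _ q])
qed

lemma forest_reaches:
  assumes "rooted_forest V E X q" "v \<in> V"
  shows "\<exists>k. (q ^^ k) v \<in> X"
proof (cases "v \<in> X")
  case True
  then show ?thesis by (intro exI[of _ 0]) simp
qed (use assms in \<open>auto simp: rooted_forest_def\<close>)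

lemma finite_forest_orbit:
  assumes "rooted_forest V E X q" "s \<in> V"
  shows "finite (range (\<lambda>k. (q ^^ k) s))"
proof -
  have fix_X: "q x = x" if "x \<in> X" for x using assms that by (auto simp: rooted_forest_def)
  obtain k where k: "(q ^^ k) s \<in> X" using forest_reaches[OF assms] by blast
  have "(q ^^ (i + k)) s = (q ^^ k) s" for i
    by (induction i) (auto simp: fix_X k)
  then have "(q ^^ i) s \<in> (\<lambda>k. (q ^^ k) s) ` {..k}" for i
    by (cases "i \<le> k") (auto, metis atMost_iff image_eqI le_add_diff_inverse2 linear order_refl)
  then show ?thesis by (meson finite_atMost finite_imageI finite_subset image_subsetI)
qed

lemma forest_closed: "rooted_forest V E X q \<Longrightarrow> X \<subseteq> V \<Longrightarrow> v \<in> V \<Longrightarrow> (q ^^ k) v \<in> V"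
  by (induction k) (auto simp: rooted_forest_def)

text \<open>
  The key step: for an undominated ray, being separated from \<open>X\<close> by a finite set passes on to
  \<open>grow V E X q\<close>. The set \<open>S1\<close> below separates a tail of \<open>R\<close> from \<open>X\<close> and its neighbours, and \<open>A\<close> consists
  of the images of \<open>S1\<close> under all iterates of \<open>q\<close>.
\<close>

lemma cut_off_grow:
  assumes R: "ray V E R" and X: "X \<subseteq> V" and q: "rooted_forest V E X q"
    and undom: "\<And>v. v \<in> V \<Longrightarrow> \<nexists>P. infinite_fan V E v R P"
    and cut: "cut_off V E R X S m"
  shows "\<exists>S m. cut_off V E R (grow V E X q) S m"
proof -
  have RV: "R i \<in> V" for i using R by (auto simp: ray_def)
  have S: "finite S" "\<And>i. i \<ge> m \<Longrightarrow> R i \<notin> S" "\<And>x. reach V E S (R m) x \<Longrightarrow> x \<notin> X"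
    using cut by (auto simp: cut_off_def)
  have "\<forall>v\<in>V. \<exists>T k. cut_off V E R {v} T k \<and> v \<notin> T"
    using undominated_separable[OF R] undom by blast
  then obtain T k where Tk: "\<And>v. v \<in> V \<Longrightarrow> cut_off V E R {v} (T v) (k v)" "\<And>v. v \<in> V \<Longrightarrow> v \<notin> T v"
    by metis
  define S1 where "S1 = (S \<union> (\<Union>v\<in>S \<inter> V. T v)) \<inter> V"
  have fin1: "finite S1" using S(1) Tk(1) by (auto simp: S1_def cut_off_def)
  define A where "A = (\<Union>s\<in>S1. range (\<lambda>k. (q ^^ k) s))"
  have finA: "finite A" unfolding A_def
    by (rule finite_UN_I[OF fin1 finite_forest_orbit[OF q]]) (simp add: S1_def)
  have S1A: "S1 \<subseteq> A"
  proof
    fix s assume "s \<in> S1"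
    moreover have "s = (q ^^ 0) s" by simp
    ultimately show "s \<in> A" unfolding A_def by blast
  qed
  obtain m0 where m0: "\<forall>i\<ge>m0. R i \<notin> A" using ray_eventually_avoids[OF R finA] by blast
  define M where "M = Max (insert m0 (insert m (k ` (S \<inter> V))))"
  have finM: "finite (insert m0 (insert m (k ` (S \<inter> V))))" using S(1) by auto
  have M: "m0 \<le> M" "m \<le> M" "\<And>v. v \<in> S \<inter> V \<Longrightarrow> k v \<le> M"
    unfolding M_def by (rule Max_ge[OF finM], simp)+
  have tailA: "\<forall>i\<ge>M. R i \<notin> A" using m0 M by auto
  let ?K = "Collect (reach V E S1 (R M))"
  have KV: "x \<in> V - S1" if "x \<in> ?K" for x
    using reach_avoids[of V E S1 "R M" x] that tailA S1A RV by auto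
  have K_T: "reach V E (T' \<inter> V) (R j) x"
    if "x \<in> ?K" "T' \<inter> V \<subseteq> S1" "j \<le> M" "\<forall>i\<ge>j. R i \<notin> T'" for x T' j
  proof -
    have "reach V E (T' \<inter> V) (R j) (R M)" using that(4) by (intro ray_tail_reach[OF R _ that(3)]) simp
    moreover have "reach V E (T' \<inter> V) (R M) x"
      using that(1) by (intro reach_antimono[OF _ that(2)]) simp
    ultimately show ?thesis by (rule rtranclp_trans)
  qed
  \<comment> \<open>Only the vertices in a separator matter.\<close>
  have cap: "reach V E (T' \<inter> V) = reach V E T'" for T'
    by (rule arg_cong[of _ _ rtranclp]) (auto simp: adj_avoiding_def fun_eq_iff)
  have K_S: "reach V E S (R m) x" if "x \<in> ?K" for x
    using K_T[OF that, of S m] M S by (auto simp: cap S1_def)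
  \<comment> \<open>A vertex of \<open>X\<close> next to \<open>?K\<close> lies in \<open>S\<close>, hence is separated from the ray by its own \<open>T\<close>.\<close>
  have K_nbr: "{x, y} \<notin> E" if x: "x \<in> ?K" and y: "y \<in> X" for x y
  proof
    assume e: "{x, y} \<in> E"
    have xV: "x \<in> V" using KV[OF x] by auto
    have yV: "y \<in> V" using y X by auto
    show False
    proof (cases "y \<in> S")
      case False
      have "x \<notin> S" using KV[OF x] by (auto simp: S1_def)
      then have "adj_avoiding V E S x y" using e xV yV False by (auto simp: adj_avoiding_def)
      with K_S[OF x] have "reach V E S (R m) y" by (rule rtranclp.rtrancl_into_rtrancl)
      then show False using S(3) y by blast
    next
      case True
      have T: "\<forall>i\<ge>k y. R i \<notin> T y" "\<not> reach V E (T y) (R (k y)) y"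
        using Tk(1)[OF yV] by (auto simp: cut_off_def)
      have r: "reach V E (T y) (R (k y)) x"
        using K_T[OF x, of "T y" "k y"] T M(3)[of y] True yV by (auto simp: cap S1_def)
      have "x \<notin> T y" using KV[OF x] True yV by (auto simp: S1_def)
      then have "adj_avoiding V E (T y) x y"
        using e xV yV Tk(2)[OF yV] by (auto simp: adj_avoiding_def)
      with r have "reach V E (T y) (R (k y)) y" by (rule rtranclp.rtrancl_into_rtrancl)
      with T(2) show False ..
    qed
  qed
  have K_X: "x \<notin> X" if "x \<in> ?K" for x using S(3)[OF K_S[OF that]] .
  \<comment> \<open>A forest path from outside \<open>?K\<close> into \<open>?K\<close> passes through \<open>S1\<close>.\<close>
  have enter: "(q ^^ i) u \<in> A" if u: "u \<in> V - X" "u \<notin> ?K" and i: "(q ^^ i) u \<in> ?K" for u i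
    using i
  proof (induction i)
    case 0
    then show ?case using u by simp
  next
    case (Suc i)
    let ?w = "(q ^^ i) u"
    have wV: "?w \<in> V" using forest_closed[OF q X] u by auto
    show ?case
    proof (cases "?w \<in> ?K")
      case True
      then obtain s l where "s \<in> S1" "?w = (q ^^ l) s" using Suc.IH unfolding A_def by blast
      then have "(q ^^ Suc i) u = (q ^^ Suc l) s" by simp
      then show ?thesis using \<open>s \<in> S1\<close> unfolding A_def by blast
    next
      case False
      have "?w \<notin> X"
      proof
        assume "?w \<in> X"
        moreover from this have "(q ^^ Suc i) u = ?w" using q by (simp add: rooted_forest_def)
        ultimately show False using K_X Suc.prems by simp
      qed
      then have "{?w, q ?w} \<in> E" using q wV by (auto simp: rooted_forest_def)
      then have "?w \<in> S1 \<or> adj_avoiding V E S1 (q ?w) ?w"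
        using wV KV[OF Suc.prems] by (auto simp: adj_avoiding_def insert_commute)
      moreover have "\<not> adj_avoiding V E S1 (q ?w) ?w"
        using False Suc.prems by (auto dest: rtranclp.rtrancl_into_rtrancl)
      ultimately have "?w \<in> S1" by blast
      moreover have "(q ^^ Suc i) u = (q ^^ 1) ?w" by simp
      ultimately show ?thesis unfolding A_def by blast
    qed
  qed
  have "cut_off V E R (grow V E X q) A M"
    unfolding cut_off_def
  proof (intro conjI allI impI)
    fix x assume x: "reach V E A (R M) x"
    have "reach V E S1 (R M) x" using reach_antimono[OF x S1A] .
    then have xK: "x \<in> ?K" by simp
    have xA: "x \<notin> A" using reach_avoids[OF x] tailA RV by auto
    show "x \<notin> grow V E X q"
    proof
      assume "x \<in> grow V E X q"
      then obtain u i where u: "u \<in> V - X" "x = (q ^^ i) u" "\<exists>y\<in>X. {y, u} \<in> E"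
        using K_X[OF xK] by (auto simp: grow_def)
      have "u \<notin> ?K" using K_nbr[of u] u(3) by (auto simp: insert_commute)
      then show False using enter[OF u(1)] xK xA u(2) by blast
    qed
  qed (use finA tailA in auto)
  then show ?thesis by blast
qed

section \<open>The spanning tree\<close>

text \<open>
  The sets \<open>X n\<close> grow from \<open>{r}\<close>; \<open>q n\<close> is the parent map of a spanning forest of \<open>G - X n\<close>.
\<close>

locale growing_forests =
  fixes V :: "'a set" and E :: "'a set set" and r :: 'a and X :: "nat \<Rightarrow> 'a set"
    and q :: "nat \<Rightarrow> 'a \<Rightarrow> 'a"
  assumes conn: "connected_graph V E" and r: "r \<in> V"
    and X0: "X 0 = {r}" and X_Suc: "\<And>n. X (Suc n) = grow V E (X n) (q n)"
    and X_V: "\<And>n. X n \<subseteq> V" and forest: "\<And>n. rooted_forest V E (X n) (q n)"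
begin

lemma X_mono: "m \<le> n \<Longrightarrow> X m \<subseteq> X n"
  by (rule lift_Suc_mono_le[of X]) (auto simp: X_Suc grow_def)

lemma r_X: "r \<in> X n" using X_mono[of 0 n] X0 by auto

lemma nbr_X: "x \<in> X n \<Longrightarrow> {x, u} \<in> E \<Longrightarrow> u \<in> V \<Longrightarrow> u \<in> X (Suc n)"
proof (cases "u \<in> X n")
  case False
  assume "x \<in> X n" "{x, u} \<in> E" "u \<in> V"
  then have "(q n ^^ 0) u \<in> grow V E (X n) (q n)" using False unfolding grow_def by blast
  then show ?thesis by (simp add: X_Suc)
qed (use X_mono[of n "Suc n"] in auto)

lemma X_exhausts: assumes "v \<in> V" shows "\<exists>n. v \<in> X n"
  using connected_reach[OF conn r assms]
proof (induction rule: rtranclp_induct)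
  case base
  show ?case using X0 by blast
next
  case (step y z)
  then show ?case using nbr_X by (fastforce simp: adj_avoiding_def)
qed

text \<open>
  A vertex other than \<open>r\<close> has level \<open>n\<close> if it is added in passing from \<open>X n\<close> to \<open>X (Suc n)\<close>. Its parent
  is the one in the forest of \<open>G - X n\<close>.
\<close>

definition level :: "'a \<Rightarrow> nat" where "level v = (LEAST n. v \<in> X (Suc n))"

definition parent :: "'a \<Rightarrow> 'a" where
  "parent v = (if v = r then r else q (level v) v)"

lemma level:
  assumes "v \<in> V" "v \<noteq> r"
  shows "v \<in> X (Suc (level v)) - X (level v)"
proof -
  obtain n where "v \<in> X n" using X_exhausts assms by blast
  then have "\<exists>n. v \<in> X (Suc n)" using X_mono[of n "Suc n"] by auto
  then have "v \<in> X (Suc (level v))" unfolding level_def by (rule LeastI_ex)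
  moreover have "v \<notin> X (level v)"
  proof (cases "level v")
    case 0
    then show ?thesis using assms X0 by simp
  next
    case (Suc n)
    then show ?thesis using not_less_Least[of n "\<lambda>n. v \<in> X (Suc n)"] by (simp add: level_def)
  qed
  ultimately show ?thesis by simp
qed

lemma level_eq:
  assumes "v \<in> X (Suc n) - X n"
  shows "level v = n"
proof -
  have "v \<in> V" "v \<noteq> r" using assms X_V r_X by auto
  note l = level[OF this]
  show ?thesis
  proof (rule linorder_cases[of "level v" n])
    assume "level v < n"
    then show ?thesis using X_mono[of "Suc (level v)" n] l assms by auto
  next
    assume "n < level v"
    then show ?thesis using X_mono[of "Suc n" "level v"] l assms by auto
  qed
qed

lemma parent_eq: "v \<in> X (Suc n) - X n \<Longrightarrow> parent v = q n v"
  using level_eq[of v n] r_X[of n] by (auto simp: parent_def)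

lemma parent_edge: "v \<in> V \<Longrightarrow> v \<noteq> r \<Longrightarrow> parent v \<in> V \<and> {v, parent v} \<in> E"
  using level[of v] forest[of "level v"] by (auto simp: parent_def rooted_forest_def)

lemma forest_step_X: "v \<in> X (Suc n) \<Longrightarrow> q n v \<in> X (Suc n)"
proof (cases "v \<in> X n")
  case True
  assume "v \<in> X (Suc n)"
  then show ?thesis using True forest[of n] by (simp add: rooted_forest_def)
next
  case False
  assume "v \<in> X (Suc n)"
  then obtain k u where *: "u \<in> V - X n" "\<exists>x\<in>X n. {x, u} \<in> E" "v = (q n ^^ k) u"
    using False by (auto simp: X_Suc grow_def)
  then have "q n v = (q n ^^ Suc k) u" by simp
  then show ?thesis using *(1,2) unfolding X_Suc grow_def by blast
qed

lemma parent_reaches_root: "v \<in> X n \<Longrightarrow> \<exists>k. (parent ^^ k) v = r"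
proof (induction n arbitrary: v)
  case 0
  then show ?case using X0 by (intro exI[of _ 0]) simp
next
  case (Suc n)
  have descend: "(q n ^^ k) w \<in> X n \<Longrightarrow> w \<in> X (Suc n) \<Longrightarrow> \<exists>j. (parent ^^ j) w = r" for k w
  proof (induction k arbitrary: w)
    case 0
    then show ?case using Suc.IH by simp
  next
    case (Suc k)
    show ?case
    proof (cases "w \<in> X n")
      case False
      then have pw: "parent w = q n w" using Suc.prems by (intro parent_eq) simp
      have "(q n ^^ k) (parent w) \<in> X n"
        using Suc.prems(1) by (simp add: pw funpow_Suc_right del: funpow.simps)
      then obtain j where "(parent ^^ j) (parent w) = r"
        using Suc.IH[of "parent w"] forest_step_X[OF Suc.prems(2)] pw by auto
      then show ?thesis by (intro exI[of _ "Suc j"]) (simp add: funpow_Suc_right del: funpow.simps)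
    qed (use \<open>\<And>v. v \<in> X n \<Longrightarrow> \<exists>k. (parent ^^ k) v = r\<close> in blast)
  qed
  show ?case
  proof (cases "v \<in> X n")
    case False
    have "\<exists>k. (q n ^^ k) v \<in> X n" using forest_reaches[OF forest] Suc.prems X_V by blast
    then show ?thesis using descend Suc.prems by blast
  qed (use Suc.IH in blast)
qed

sublocale parent_tree V r parent
proof
  show "r \<in> V" by (rule r)
  show "parent r = r" by (simp add: parent_def)
  show "parent v \<in> V" if "v \<in> V" for v using parent_edge[OF that] r by (auto simp: parent_def)
  show "\<exists>k. (parent ^^ k) v = r" if "v \<in> V" for v
    using X_exhausts[OF that] parent_reaches_root by blast
qed

lemma spanning: "rooted_spanning_tree V E (parent_edges V r parent) r"
  using parent_edges_tree parent_edge r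
  by (auto simp: rooted_spanning_tree_def parent_edges_def)

text \<open>
  If the step from \<open>v\<close> to its parent leaves the component of \<open>v\<close> in \<open>G - X n\<close>, then it leads into \<open>X n\<close>.
  So \<open>v\<close> has a neighbour in \<open>X n\<close>, therefore belongs to \<open>X (Suc n)\<close>, and is the root of that component
  in the forest of \<open>G - X n\<close>.
\<close>

lemma parent_leaves_component:
  assumes "v \<in> V - X n" "\<not> reach V E (X n) v (parent v)"
  shows "parent v \<in> X n" "v \<in> X (Suc n)" "parent v = q n v"
proof -
  have v: "v \<in> V" "v \<noteq> r" using assms r_X by auto
  note e = parent_edge[OF v]
  show pX: "parent v \<in> X n"
  proof (rule ccontr)
    assume "parent v \<notin> X n"
    then have "adj_avoiding V E (X n) v (parent v)" using e assms(1) by (auto simp: adj_avoiding_def)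
    then show False using assms(2) by blast
  qed
  show "v \<in> X (Suc n)" using nbr_X[OF pX] e v by (auto simp: insert_commute)
  then show "parent v = q n v" using assms(1) by (intro parent_eq) auto
qed

lemma entry_unique:
  assumes "u \<in> V - X n" "v \<in> V - X n" "reach V E (X n) u v"
    "\<not> reach V E (X n) u (parent u)" "\<not> reach V E (X n) v (parent v)"
  shows "u = v"
proof -
  have "q n u \<in> X n" "q n v \<in> X n"
    using parent_leaves_component[OF assms(1,4)] parent_leaves_component[OF assms(2,5)] by auto
  then show ?thesis using forest[of n] assms unfolding rooted_forest_def by blast
qed

text \<open>
  The path from \<open>v\<close> to the root of the tree leaves the component of \<open>v\<close> in \<open>G - X n\<close>, since \<open>r\<close> lies
  in \<open>X n\<close>.
\<close>

lemma entry_exists: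
  assumes "v \<in> V - X n"
  shows "\<exists>k\<le>depth v. reach V E (X n) v ((parent ^^ k) v) \<and>
           \<not> reach V E (X n) ((parent ^^ k) v) (parent ((parent ^^ k) v))"
proof -
  define k where "k = (LEAST k. \<not> reach V E (X n) v ((parent ^^ k) v))"
  have out: "\<not> reach V E (X n) v ((parent ^^ depth v) v)"
    using reach_avoids[of V E "X n" v r] assms r_X funpow_depth by auto
  then have k: "\<not> reach V E (X n) v ((parent ^^ k) v)" unfolding k_def by (rule LeastI)
  have "k \<le> depth v" unfolding k_def using out by (rule Least_le)
  moreover have "k \<noteq> 0" using k by (auto intro: ccontr)
  then obtain j where j: "k = Suc j" by (cases k) auto
  have "reach V E (X n) v ((parent ^^ j) v)"
    using not_less_Least[of j] j unfolding k_def by (metis lessI)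
  moreover from this have "\<not> reach V E (X n) ((parent ^^ j) v) (parent ((parent ^^ j) v))"
    using k j by (auto dest: rtranclp_trans)
  ultimately show ?thesis using j by (intro exI[of _ j]) auto
qed

lemma unique_ray:
  assumes R: "ray V E R"
    and undom: "\<And>v. v \<in> V \<Longrightarrow> \<nexists>P. infinite_fan V E v R P"
  shows "\<exists>!Q. ray V (parent_edges V r parent) Q \<and> Q 0 = r \<and> (R, Q) \<in> ray_equiv V E"
proof -
  have RV: "R i \<in> V" for i using R by (auto simp: ray_def)
  have "\<exists>S m. cut_off V E R (X n) S m" for n
  proof (induction n)
    case 0
    obtain m where m: "\<forall>i\<ge>m. R i \<notin> {r}" using ray_eventually_avoids[OF R, of "{r}"] by auto
    have "x \<notin> {r}" if "reach V E {r} (R m) x" for x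
      using reach_avoids[OF that] m RV by auto
    then have "cut_off V E R (X 0) {r} m" using m X0 by (auto simp: cut_off_def)
    then show ?case by blast
  next
    case (Suc n)
    then show ?case using cut_off_grow[OF R X_V forest undom] X_Suc by metis
  qed
  then obtain S m where cut: "\<And>n. cut_off V E R (X n) (S n) (m n)" by metis
  have S: "finite (S n)" "\<And>i. i \<ge> m n \<Longrightarrow> R i \<notin> S n" "\<And>x. reach V E (S n) (R (m n)) x \<Longrightarrow> x \<notin> X n"
    for n using cut[of n] by (auto simp: cut_off_def)
  define C where "C n = Collect (reach V E (X n) (R (m n)))" for n
  have S_C: "x \<in> C n" if "reach V E (S n) (R (m n)) x" for n x
    unfolding C_def using reach_change[OF that S(3)] by simp
  have R_C: "R i \<in> C n" if "i \<ge> m n" for i n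
    using that S(2) by (intro S_C ray_tail_reach[OF R]) auto
  have start: "R (m n) \<in> V - X n" for n using S(3)[of n "R (m n)"] RV by auto
  have C_V: "x \<in> V - X n" if "x \<in> C n" for x n
    using that reach_avoids[OF _ start] by (auto simp: C_def)
  have C_reach: "reach V E (X n) x y" if "x \<in> C n" "y \<in> C n" for n x y
    using that reach_sym unfolding C_def by (metis mem_Collect_eq rtranclp_trans)
  have C_closed: "y \<in> C n" if "x \<in> C n" "reach V E (X n) x y" for x y n
    using that unfolding C_def by (auto intro: rtranclp_trans)
  have C_anti: "C (Suc n) \<subseteq> C n" for n
  proof
    fix x assume x: "x \<in> C (Suc n)"
    define i where "i = max (m n) (m (Suc n))"
    have "R i \<in> C (Suc n)" "R i \<in> C n" using R_C by (auto simp: i_def)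
    moreover have "reach V E (X (Suc n)) (R i) x" using C_reach x calculation by blast
    then have "reach V E (X n) (R i) x" by (rule reach_antimono) (simp add: X_mono)
    ultimately show "x \<in> C n" using C_closed by blast
  qed
  \<comment> \<open>The tree enters the component \<open>C n\<close>, which contains a tail of \<open>R\<close>, at a single vertex \<open>c n\<close>.\<close>
  have "\<exists>c. c \<in> C n \<and> parent c \<notin> C n" for n
    using entry_exists[OF start[of n]] C_closed R_C[of n "m n"] C_reach by (metis order_refl)
  then obtain c where c: "\<And>n. c n \<in> C n" "\<And>n. parent (c n) \<notin> C n" by metis
  have c_eq: "v = c n" if "v \<in> C n" "parent v \<notin> C n" for v n
    using that c C_reach C_closed C_V by (intro entry_unique[of v n "c n"]) blast+
  \<comment> \<open>Going from \<open>c (Suc n)\<close> to the root, the tree leaves \<open>C n\<close> at \<open>c n\<close>; the two differ because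
      \<open>c n\<close> lies in \<open>X (Suc n)\<close>.\<close>
  have anc: "\<exists>k>0. k \<le> depth (c (Suc n)) \<and> (parent ^^ k) (c (Suc n)) = c n" for n
  proof -
    let ?v = "c (Suc n)"
    have v: "?v \<in> C n" using c(1) C_anti by blast
    obtain k where k: "k \<le> depth ?v" "reach V E (X n) ?v ((parent ^^ k) ?v)"
      "\<not> reach V E (X n) ((parent ^^ k) ?v) (parent ((parent ^^ k) ?v))"
      using entry_exists[OF C_V[OF v]] by blast
    have "(parent ^^ k) ?v = c n" using k v C_closed C_reach by (intro c_eq) blast+
    moreover have "c n \<in> X (Suc n)"
      using parent_leaves_component(2)[OF C_V[OF c(1)]] c C_closed by blast
    then have "c n \<noteq> ?v" using C_V[OF c(1)[of "Suc n"]] by auto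
    ultimately show ?thesis using k by (metis funpow_0 gr0I)
  qed
  have cV: "c n \<in> V" for n using C_V[OF c(1)] by auto
  obtain Q where Q: "ray V (parent_edges V r parent) Q" "Q 0 = r"
    and Qc: "\<And>n. n \<le> depth (c n)" "\<And>n. Q (depth (c n)) = c n"
    using branch_ray[of c, OF cV anc] by blast
  have rayE: "ray V E Q'" if "ray V (parent_edges V r parent) Q'" for Q'
    using that spanning by (auto simp: ray_def rooted_spanning_tree_def)
  have "\<not> separates V E T (range R) (range Q)" if T: "finite T" "T \<subseteq> V" for T
  proof -
    have "\<forall>t\<in>T. \<exists>n. t \<in> X n" using X_exhausts T by blast
    then obtain f where f: "\<forall>t\<in>T. t \<in> X (f t)" by metis
    define n where "n = Max (insert 0 (f ` T))"
    have "f t \<le> n" if "t \<in> T" for t using that T by (auto simp: n_def intro!: Max_ge)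
    then have TX: "T \<subseteq> X n" using f X_mono by blast
    have "reach V E (X n) (R (m n)) (c n)" using c(1) by (simp add: C_def)
    from reach_imp_path[OF this start]
    obtain xs where xs: "graph_path V E xs" "hd xs = R (m n)" "last xs = c n" "set xs \<inter> X n = {}"
      by blast
    have "last xs \<in> range Q" using xs(3) Qc(2) by (metis rangeI)
    then show ?thesis using xs TX unfolding separates_def by (metis Int_mono order_refl rangeI subset_empty)
  qed
  then have equiv: "(R, Q) \<in> ray_equiv V E" using R rayE Q by (auto simp: ray_equiv_def)
  have uniq: "Q' = Q" if Q': "ray V (parent_edges V r parent) Q'" "Q' 0 = r" "(R, Q') \<in> ray_equiv V E" for Q'
  proof
    fix j
    have Q'E: "ray V E Q'" using rayE Q' by blast
    have Q'V: "Q' i \<in> V" for i using Q'E by (auto simp: ray_def)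
    obtain M where M: "\<forall>i\<ge>M. Q' i \<notin> S j" using ray_eventually_avoids[OF Q'E S(1)] by blast
    \<comment> \<open>Deleting initial segments as well yields a path between the tails of \<open>R\<close> and \<open>Q'\<close>.\<close>
    define T where "T = S j \<inter> V \<union> R ` {..<m j} \<union> Q' ` {..<M}"
    have "finite T" "T \<subseteq> V" using S(1) RV Q'V by (auto simp: T_def)
    then have "\<not> separates V E T (range R) (range Q')" using Q'(3) by (auto simp: ray_equiv_def)
    then obtain xs a b where xs: "graph_path V E xs" "hd xs = R a" "last xs = Q' b" "set xs \<inter> T = {}"
      by (auto simp: separates_def)
    have "R a \<notin> T" "Q' b \<notin> T"
      using xs by (metis disjoint_iff graph_path_def hd_in_set last_in_set)+
    then have ab: "m j \<le> a" "M \<le> b" by (auto simp: T_def not_less[symmetric])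
    have "set xs \<inter> S j = {}" using xs by (auto simp: T_def graph_path_def)
    then have "reach V E (S j) (R a) (Q' b)" using path_imp_reach[OF xs(1)] xs(2,3) by metis
    moreover have "reach V E (S j) (R (m j)) (R a)" using ab S(2) by (intro ray_tail_reach[OF R]) auto
    ultimately have bC: "Q' b \<in> C j" by (intro S_C) (rule rtranclp_trans)
    have "Q' 0 \<notin> C j" using Q'(2) C_V r_X by auto
    \<comment> \<open>The ray \<open>Q'\<close> starts outside \<open>C j\<close> and enters it, necessarily at \<open>c j\<close>, which has depth at
        least \<open>j\<close>; so \<open>Q'\<close> and \<open>Q\<close> agree up to index \<open>j\<close>.\<close>
    define i where "i = (LEAST i. Q' i \<in> C j)"
    have iC: "Q' i \<in> C j" unfolding i_def using bC by (rule LeastI)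
    then obtain i' where i': "i = Suc i'" using \<open>Q' 0 \<notin> C j\<close> by (cases i) auto
    have "Q' i' \<notin> C j" using not_less_Least[of i'] i' unfolding i_def by (metis lessI)
    then have "Q' i = c j" using iC i' root_ray_parent(1)[OF Q'(1,2)] by (intro c_eq) auto
    moreover from this have "i = depth (c j)" using root_ray_parent(2)[OF Q'(1,2), of i] by simp
    ultimately have "Q' (j + (depth (c j) - j)) = Q (j + (depth (c j) - j))"
      using Qc[of j] by simp
    then show "Q' j = Q j"
      using root_ray_below[OF Q'(1,2)] root_ray_below[OF Q] by metis
  qed
  show ?thesis using Q equiv uniq by blast
qed

lemma end_faithful_parent_edges:
  "end_faithful V (parent_edges V r parent) r (topological_ends V E)"
  unfolding end_faithful_def
proof
  fix \<omega> assume \<omega>: "\<omega> \<in> topological_ends V E"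
  then obtain R where R: "ray V E R" "\<omega> = ray_equiv V E `` {R}"
    by (auto simp: topological_ends_def vertex_ends_def quotient_def)
  have "\<not> separates V E S (range R) (range R)" if S: "finite S" for S
  proof -
    obtain i where "R i \<notin> S" using ray_eventually_avoids[OF R(1) S] by blast
    moreover have "graph_path V E [R i]" using R by (auto simp: graph_path_def ray_def)
    ultimately show ?thesis unfolding separates_def
      by (auto intro!: exI[of _ "[R i]"])
  qed
  then have "R \<in> \<omega>" using R by (auto simp: ray_equiv_def)
  then have "\<And>v. v \<in> V \<Longrightarrow> \<nexists>P. infinite_fan V E v R P"
    using \<omega> unfolding topological_ends_def dominates_def by blast
  from unique_ray[OF R(1) this]
  show "\<exists>!Q. ray V (parent_edges V r parent) Q \<and> Q 0 = r \<and> Q \<in> \<omega>" by (simp add: R(2))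
qed

end

theorem corollary2p6:
  fixes V :: "'a set" and E :: "'a set set"
  assumes "simple_graph V E" and "connected_graph V E"
  shows "\<exists>F r. rooted_spanning_tree V E F r \<and> end_faithful V F r (topological_ends V E)"
proof -
  obtain r where r: "r \<in> V" using assms(2) by (auto simp: connected_graph_def)
  define q where "q X = (SOME q. rooted_forest V E X q)" for X
  define X where "X n = ((\<lambda>Y. grow V E Y (q Y)) ^^ n) {r}" for n
  have q: "rooted_forest V E Y (q Y)" if "Y \<subseteq> V" "r \<in> Y" for Y
    unfolding q_def using rooted_forest_exists[OF assms(2) that] by (rule someI_ex)
  have X: "X n \<subseteq> V \<and> r \<in> X n" for n
  proof (induction n)
    case 0
    show ?case using r by (simp add: X_def)
  next
    case (Suc n)
    then have "grow V E (X n) (q (X n)) \<subseteq> V"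
      using forest_closed[OF q] by (auto simp: grow_def)
    then show ?case using Suc by (auto simp: X_def grow_def)
  qed
  interpret growing_forests V E r X "\<lambda>n. q (X n)"
    by standard (use assms r X q in \<open>auto simp: X_def\<close>)
  show ?thesis using spanning end_faithful_parent_edges by blast
qed

end
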